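(* Let $R$ be a finite commutative ring with unity and let $\Gamma'^{c}(R)$ be the complement unity product graph associated with $R$. Then $\gamma(\Gamma'^{c}(R))=1$.
   Context: For a ring $R$ with unity $e$, let $U(R)$ denote the set of units of $R$. The complement unity product graph $\Gamma'^{c}(R)$ is the simple graph with vertex set $U(R)$ in which two distinct vertices $r_i,r_j$ are adjacent if and only if $r_i\cdot r_j\neq e$. A dominating set of a graph $\Gamma$ is a set $D$ of vertices such that every vertex not in $D$ is adjacent to some vertex in $D$; the domination number $\gamma(\Gamma)$ is the minimum cardinality of a dominating set. *)

theory Defs
  imports "HOL-Algebra.Ring" "Graph_Theory.Pair_Digraph"
begin

text \<open>
  Simple graphs are, as in \<^theory>\<open>Graph_Theory.Digraph\<close>, symmetric loop-free digraphs without
  parallel arcs; an edge \<open>{u, v}\<close> is represented by the two arcs \<open>(u, v)\<close> and \<open>(v, u)\<close>.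
\<close>

definition compl_unity_product_graph :: "('a, 'm) ring_scheme \<Rightarrow> 'a pair_pre_digraph" where
  "compl_unity_product_graph R =
     \<lparr> pverts = Units R,
       parcs = {(r, s). r \<in> Units R \<and> s \<in> Units R \<and> r \<noteq> s \<and> r \<otimes>\<^bsub>R\<^esub> s \<noteq> \<one>\<^bsub>R\<^esub>} \<rparr>"

lemma (in ring) pair_graph_compl_unity_product_graph:
  assumes "finite (Units R)"
  shows "pair_graph (compl_unity_product_graph R)"
proof -
  let ?G = "compl_unity_product_graph R"
  have fin: "finite (parcs ?G)"
    by (rule finite_subset[of _ "Units R \<times> Units R"])
       (auto simp: compl_unity_product_graph_def assms)
  have comm: "s \<otimes> r = \<one>" if "r \<in> Units R" "s \<in> Units R" "r \<otimes> s = \<one>" for r s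
    using that by (metis Units_closed Units_inv_inv Units_l_inv inv_char Units_r_inv inv_unique
        Units_inv_closed)
  have "sym (parcs ?G)"
    using comm by (auto simp: compl_unity_product_graph_def intro!: symI)
  then show ?thesis
    using assms fin
    by unfold_locales (auto simp: compl_unity_product_graph_def symmetric_def)
qed

definition dominating_set :: "('a, 'b) pre_digraph \<Rightarrow> 'a set \<Rightarrow> bool" where
  "dominating_set G D \<longleftrightarrow>
     D \<subseteq> verts G \<and> (\<forall>v \<in> verts G - D. \<exists>u \<in> D. v \<rightarrow>\<^bsub>G\<^esub> u)"

text \<open>
  Finiteness of \<open>D\<close> is required because \<^const>\<open>card\<close> is \<open>0\<close> on infinite sets. The value is
  meaningful whenever some finite dominating set exists, in particular for every finite graph.
\<close>

definition domination_number :: "('a, 'b) pre_digraph \<Rightarrow> nat" where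
  "domination_number G = (LEAST n. \<exists>D. dominating_set G D \<and> finite D \<and> card D = n)"

end

theory Submission
  imports Defs
begin

text \<open>
  The unity \<open>e\<close> is adjacent to every other unit: for a unit \<open>v \<noteq> e\<close> the product \<open>v \<cdot> e = v\<close>
  differs from \<open>e\<close>. Hence \<open>{e}\<close> is a dominating set, and it has the least possible size
  because a graph with a vertex is not dominated by the empty set.
\<close>

lemma dominating_set_singleton_one:
  assumes "monoid R"
  shows "dominating_set (with_proj (compl_unity_product_graph R)) {\<one>\<^bsub>R\<^esub>}"
proof -
  interpret monoid R by fact
  show ?thesis
    by (auto simp: dominating_set_def compl_unity_product_graph_def arcs_ends_conv Units_closed)
qed

lemma not_dominating_set_empty:
  assumes "verts G \<noteq> {}"
  shows "\<not> dominating_set G {}"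
  using assms by (auto simp: dominating_set_def)

lemma domination_number_eq_1I:
  assumes dom: "dominating_set G {v}"
  shows "domination_number G = 1"
proof -
  have "verts G \<noteq> {}"
    using dom by (auto simp: dominating_set_def)
  then have empty: "\<not> dominating_set G {}"
    by (rule not_dominating_set_empty)
  show ?thesis
    unfolding domination_number_def
  proof (rule Least_equality)
    show "\<exists>D. dominating_set G D \<and> finite D \<and> card D = 1"
      using dom by (intro exI[of _ "{v}"]) simp
  next
    fix n assume "\<exists>D. dominating_set G D \<and> finite D \<and> card D = n"
    with empty show "1 \<le> n"
      by (auto simp: Suc_le_eq card_gt_0_iff)
  qed
qed

theorem theorem5p3:
  fixes R :: "('a, 'm) ring_scheme"
  assumes "cring R" and "finite (carrier R)"
  shows "domination_number (with_proj (compl_unity_product_graph R)) = 1"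
proof -
  interpret cring R by fact
  show ?thesis
    by (rule domination_number_eq_1I[OF dominating_set_singleton_one]) unfold_locales
qed

end
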